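(* Let $\mathcal{MG}(\mathcal{S},\mathcal{A},P,r,N,\gamma,d_0)$ be a multi-agent Markov game in which the individual agent objective function is decomposed as $$r(s,a)\stackrel{\text{def}}{=}\sum_{c=1}^{C}\sigma_c\,r_c(s,a),$$ where $\sigma_c\in[0,1]$, $\sum_{c=1}^{C}\sigma_c=1$, $\sigma_c$ is the weight of the $c$-th decomposed reward, and $r_c(s,a)\in\mathbb{R}$ is the $c$-th reward component for the state-action pair $(s,a)$. For agent $i$ the reward, weights and components are written $r_i$, $\sigma_{c,i}$, $r_{c,i}$, so that $r_i(s_i,a_i)=\sum_{c=1}^{C}\sigma_{c,i}\,r_{c,i}(s_i,a_i)$. Let the corresponding Q-value function of the $i$-th agent under policy $\pi$ be $$Q_i^{\pi}\stackrel{\text{def}}{=}\mathbb{E}_{\pi}\left[\sum_{t=0}^{\infty}\gamma^t r_i(s_t,a_t)\,\middle|\,s_0=s,\ a_0=a\right],$$ and let $Q_{c,i}^{\pi}$ be the Q-value function of the $i$-th agent for its $c$-th reward component, that is, the same expression with $r_{c,i}$ in place of $r_i$. Consequently, a decomposed joint state-action Q-value function takes the form $$\bm{Q}^{\bm{\pi}}(s,\bm{a})\stackrel{\text{def}}{=}\sum_{i=1}^{N}\sum_{c=1}^{C}\sigma_{c,i}\,Q_{c,i}^{\pi}.$$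
   Context: A multi-agent Markov game is a tuple $\mathcal{MG}(\mathcal{S},\mathcal{A},P,r,N,\gamma,d_0)$, where $\mathcal{S}$ is the joint state space with elements $\bm{s}=\langle s_1,\dots,s_N\rangle$ (also written $s$); $\mathcal{A}$ is the joint action space with elements $\bm{a}=\langle a_1,\dots,a_N\rangle$; $P(\cdot\mid\bm{s},\bm{a})$ is the transition probability distribution over states when joint action $\bm{a}$ is taken in joint state $\bm{s}$; $r$ is the team reward on $\mathcal{S}\times\mathcal{A}$; $N$ is the number of agents; $\gamma$ is the discount factor; and $d_0$ is the initial state distribution. (In the claim, the symbol $r(s,a)$ is used for the reward of an individual agent.) The number of reward components is $C$. At each time step agent $i$ acts according to its policy $\pi_i(\cdot\mid s_i)$, and the joint policy is $\bm{\pi}(\cdot\mid\bm{s})=\prod_{i=1}^{N}\pi_i(\cdot\mid s_i)$. The joint state-action value function is $$\bm{Q}^{\bm{\pi}}(\bm{s},\bm{a})=\mathbb{E}_{\bm{s}_{1:\infty}\sim P,\ \bm{a}_{1:\infty}\sim\bm{\pi}}\left[\sum_{t=0}^{\infty}\gamma^t r(\bm{s}_t,\bm{a}_t)\,\middle|\,\bm{s}_0=\bm{s},\ \bm{a}_0=\bm{a}\right],$$ with $r$ the team reward. The individual value functions are taken per agent, in agent $i$'s own state and action, with $\mathbb{E}_{\pi}$ for agent $i$ meaning expectation over $s_{1:\infty}\sim P_i$ and $a_{1:\infty}\sim\pi_i$, where $P_i$ denotes agent $i$'s transition law (the source introduces $P_i$ only through this notation). Explicitly, $$Q_{i}^{\pi}=\mathbb{E}_{s_{1:\infty}\sim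 P_i,\ a_{1:\infty}\sim\pi_i}\left[\sum_{t=0}^{\infty}\gamma^t r_{i}(s_{t,i},a_{t,i})\,\middle|\,s_{0,i}=s_i,\ a_{0,i}=a_i\right],$$ $$Q_{c,i}^{\pi}=\mathbb{E}_{s_{1:\infty}\sim P_i,\ a_{1:\infty}\sim\pi_i}\left[\sum_{t=0}^{\infty}\gamma^t r_{c,i}(s_{t,i},a_{t,i})\,\middle|\,s_{0,i}=s_i,\ a_{0,i}=a_i\right],$$ where $s_{t,i},a_{t,i}$ are agent $i$'s state and action at time $t$.
   Formalization: The claim needs links the text omits: the team reward is assumed to be the sum over agents of r_i(s_i,a_i), P_i is taken to be the i-th marginal of P, depending only on (s_i,a_i), and the component returns are assumed to converge absolutely. *)

theory Defs
  imports "HOL-Probability.Probability"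
begin

text \<open>
  State and action spaces are arbitrary measurable spaces. A decision process is given by
  a transition kernel \<open>P\<close> from state-action pairs to states and a policy \<open>\<pi>\<close>, a kernel from states
  to actions. The same definitions serve for a single agent and for the joint process.
\<close>

definition step_kernel ::
  "'s measure \<Rightarrow> 'a measure \<Rightarrow> ('s \<times> 'a \<Rightarrow> 's measure) \<Rightarrow> ('s \<Rightarrow> 'a measure)
    \<Rightarrow> 's \<times> 'a \<Rightarrow> ('s \<times> 'a) measure" where
  "step_kernel S A P \<pi> x = P x \<bind> (\<lambda>s'. \<pi> s' \<bind> (\<lambda>a'. return (S \<Otimes>\<^sub>M A) (s', a')))"

text \<open>
  Ionescu-Tulcea kernels are indexed by the time \<open>n\<close> and take the history \<open>(\<omega> 0, \<dots>, \<omega> (n - 1))\<close>;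
  at time 0 the state-action pair is \<open>x\<close> with probability one.
\<close>

definition history_kernel ::
  "'s measure \<Rightarrow> 'a measure \<Rightarrow> ('s \<times> 'a \<Rightarrow> 's measure) \<Rightarrow> ('s \<Rightarrow> 'a measure)
    \<Rightarrow> 's \<times> 'a \<Rightarrow> nat \<Rightarrow> (nat \<Rightarrow> 's \<times> 'a) \<Rightarrow> ('s \<times> 'a) measure" where
  "history_kernel S A P \<pi> x n \<omega> =
    (case n of 0 \<Rightarrow> return (S \<Otimes>\<^sub>M A) x | Suc m \<Rightarrow> step_kernel S A P \<pi> (\<omega> m))"

text \<open>
  The law of \<open>(s\<^sub>0, a\<^sub>0), (s\<^sub>1, a\<^sub>1), \<dots>\<close> started in \<open>x = (s\<^sub>0, a\<^sub>0)\<close>: the projective limit that the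
  Ionescu-Tulcea theorem associates with the history kernels.
\<close>

definition trajectory ::
  "'s measure \<Rightarrow> 'a measure \<Rightarrow> ('s \<times> 'a \<Rightarrow> 's measure) \<Rightarrow> ('s \<Rightarrow> 'a measure)
    \<Rightarrow> 's \<times> 'a \<Rightarrow> (nat \<Rightarrow> 's \<times> 'a) measure" where
  "trajectory S A P \<pi> x =
    projective_family.lim UNIV
      (Ionescu_Tulcea.CI (history_kernel S A P \<pi> x) (\<lambda>_. S \<Otimes>\<^sub>M A)) (\<lambda>_. S \<Otimes>\<^sub>M A)"

definition Q_value ::
  "'s measure \<Rightarrow> 'a measure \<Rightarrow> ('s \<times> 'a \<Rightarrow> 's measure) \<Rightarrow> ('s \<Rightarrow> 'a measure)
    \<Rightarrow> real \<Rightarrow> ('s \<times> 'a \<Rightarrow> real) \<Rightarrow> 's \<times> 'a \<Rightarrow> real" where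
  "Q_value S A P \<pi> \<gamma> r x = (\<integral>\<omega>. (\<Sum>t. \<gamma> ^ t * r (\<omega> t)) \<partial>trajectory S A P \<pi> x)"

text \<open>
  Neither \<open>suminf\<close> nor the Bochner integral is meaningful for divergent arguments. The following
  says that the expected discounted return defining \<open>Q_value\<close> converges absolutely; it holds in
  particular whenever \<open>r\<close> is bounded and \<open>0 \<le> \<gamma> < 1\<close>.
\<close>

definition Q_well_defined ::
  "'s measure \<Rightarrow> 'a measure \<Rightarrow> ('s \<times> 'a \<Rightarrow> 's measure) \<Rightarrow> ('s \<Rightarrow> 'a measure)
    \<Rightarrow> real \<Rightarrow> ('s \<times> 'a \<Rightarrow> real) \<Rightarrow> 's \<times> 'a \<Rightarrow> bool" where
  "Q_well_defined S A P \<pi> \<gamma> r x \<longleftrightarrow>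
    (\<integral>\<^sup>+\<omega>. (\<Sum>t. ennreal (\<gamma> ^ t * \<bar>r (\<omega> t)\<bar>)) \<partial>trajectory S A P \<pi> x) < \<infinity>"

lemma measurable_step_kernel:
  assumes P[measurable]: "P \<in> S \<Otimes>\<^sub>M A \<rightarrow>\<^sub>M prob_algebra S"
    and \<pi>[measurable]: "\<pi> \<in> S \<rightarrow>\<^sub>M prob_algebra A"
  shows "step_kernel S A P \<pi> \<in> S \<Otimes>\<^sub>M A \<rightarrow>\<^sub>M prob_algebra (S \<Otimes>\<^sub>M A)"
  unfolding step_kernel_def[abs_def]
  by measurable

lemma Ionescu_Tulcea_history_kernel:
  assumes "P \<in> S \<Otimes>\<^sub>M A \<rightarrow>\<^sub>M prob_algebra S" and "\<pi> \<in> S \<rightarrow>\<^sub>M prob_algebra A"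
    and x: "x \<in> space (S \<Otimes>\<^sub>M A)"
  shows "Ionescu_Tulcea (history_kernel S A P \<pi> x) (\<lambda>_. S \<Otimes>\<^sub>M A)"
proof -
  note K[measurable] = measurable_step_kernel[OF assms(1,2)]
  have H: "history_kernel S A P \<pi> x n \<in> PiM {0..<n} (\<lambda>_. S \<Otimes>\<^sub>M A) \<rightarrow>\<^sub>M prob_algebra (S \<Otimes>\<^sub>M A)" for n
  proof (cases n)
    case 0
    with x show ?thesis
      by (auto simp: history_kernel_def[abs_def] space_prob_algebra intro!: prob_space_return)
  next
    case (Suc m)
    have "(\<lambda>\<omega>. \<omega> m) \<in> PiM {0..<Suc m} (\<lambda>_. S \<Otimes>\<^sub>M A) \<rightarrow>\<^sub>M S \<Otimes>\<^sub>M A"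
      by (rule measurable_component_singleton) simp
    from measurable_compose[OF this K] Suc show ?thesis
      by (simp add: history_kernel_def[abs_def])
  qed
  show ?thesis
  proof (intro Ionescu_Tulcea.intro)
    show "history_kernel S A P \<pi> x n \<in> PiM {0..<n} (\<lambda>_. S \<Otimes>\<^sub>M A) \<rightarrow>\<^sub>M subprob_algebra (S \<Otimes>\<^sub>M A)" for n
      by (rule measurable_prob_algebraD[OF H])
    show "prob_space (history_kernel S A P \<pi> x n \<omega>)"
      if "\<omega> \<in> space (PiM {0..<n} (\<lambda>_. S \<Otimes>\<^sub>M A))" for n \<omega>
      using measurable_space[OF H that] by (simp add: space_prob_algebra)
  qed
qed

text \<open>
  Agents are numbered \<open>1, \<dots>, N\<close>. Joint states and joint actions are elements of the product space
  over \<open>{1..N}\<close>; the factors may differ from agent to agent.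
\<close>

abbreviation joint_space :: "nat \<Rightarrow> (nat \<Rightarrow> 'b measure) \<Rightarrow> (nat \<Rightarrow> 'b) measure" where
  "joint_space N M \<equiv> PiM {1..N} M"

definition joint_policy ::
  "nat \<Rightarrow> (nat \<Rightarrow> 's \<Rightarrow> 'a measure) \<Rightarrow> (nat \<Rightarrow> 's) \<Rightarrow> (nat \<Rightarrow> 'a) measure" where
  "joint_policy N \<pi> s = PiM {1..N} (\<lambda>i. \<pi> i (s i))"

locale markov_game =
  fixes N :: nat
    and S :: "nat \<Rightarrow> 's measure"
    and A :: "nat \<Rightarrow> 'a measure"
    and P :: "(nat \<Rightarrow> 's) \<times> (nat \<Rightarrow> 'a) \<Rightarrow> (nat \<Rightarrow> 's) measure"
    and r :: "(nat \<Rightarrow> 's) \<times> (nat \<Rightarrow> 'a) \<Rightarrow> real"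
    and \<gamma> :: real
    and d\<^sub>0 :: "(nat \<Rightarrow> 's) measure"
  assumes transition:
      "P \<in> joint_space N S \<Otimes>\<^sub>M joint_space N A \<rightarrow>\<^sub>M prob_algebra (joint_space N S)"
    and team_reward: "r \<in> borel_measurable (joint_space N S \<Otimes>\<^sub>M joint_space N A)"
    and discount: "0 \<le> \<gamma>" "\<gamma> \<le> 1"
    and initial: "d\<^sub>0 \<in> space (prob_algebra (joint_space N S))"

text \<open>
  \<open>P\<^sub>i\<close> is agent \<open>i\<close>'s transition law in the joint dynamics \<open>P\<close>: given the joint state \<open>s\<close> and joint
  action \<open>a\<close>, the \<open>i\<close>-th component of the next state is distributed according to
  \<open>P\<^sub>i (s i, a i)\<close>. Different components of the next state may be dependent.
\<close>

definition agent_transition ::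
  "nat \<Rightarrow> (nat \<Rightarrow> 's measure) \<Rightarrow> (nat \<Rightarrow> 'a measure)
    \<Rightarrow> ((nat \<Rightarrow> 's) \<times> (nat \<Rightarrow> 'a) \<Rightarrow> (nat \<Rightarrow> 's) measure)
    \<Rightarrow> nat \<Rightarrow> ('s \<times> 'a \<Rightarrow> 's measure) \<Rightarrow> bool" where
  "agent_transition N S A P i P\<^sub>i \<longleftrightarrow>
    P\<^sub>i \<in> S i \<Otimes>\<^sub>M A i \<rightarrow>\<^sub>M prob_algebra (S i) \<and>
    (\<forall>s\<in>space (joint_space N S). \<forall>a\<in>space (joint_space N A).
      distr (P (s, a)) (S i) (\<lambda>s'. s' i) = P\<^sub>i (s i, a i))"

end

theory Submission
  imports Defs
begin

text \<open>
  Projecting every joint state-action pair \<open>(s, a)\<close> to \<open>(s i, a i)\<close> intertwines the joint one-step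
  kernel with that of agent \<open>i\<close>: the next state's marginal is the agent's own transition law, and the
  agent's action depends only on its own state. Hence the projection maps the law of the joint
  trajectory to the law of the agent's trajectory, and the joint Q-value splits by linearity.
\<close>

section \<open>Pushforward of Ionescu-Tulcea laws along coordinatewise maps\<close>

text \<open>By the kernel hypothesis, drawing coordinate \<open>n\<close> from \<open>K\<close> and
  then applying \<open>f n\<close> has the same law as drawing it from \<open>K'\<close> at the
  already mapped history. Mapping therefore commutes with one extension step, and by induction with
  every finite horizon.\<close>

lemma Ionescu_Tulcea_C_distr:
  assumes IT: "Ionescu_Tulcea K M" and IT': "Ionescu_Tulcea K' M'"
    and f: "\<And>n. f n \<in> M n \<rightarrow>\<^sub>M M' n"
    and K: "\<And>n \<omega>. \<omega> \<in> space (PiM {0..<n} M) \<Longrightarrow>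
      distr (K n \<omega>) (M' n) (f n) = K' n (\<lambda>t\<in>{0..<n}. f t (\<omega> t))"
  shows "distr (Ionescu_Tulcea.C K M 0 n (\<lambda>_. undefined)) (PiM {0..<n} M')
      (\<lambda>\<omega>. \<lambda>t\<in>{0..<n}. f t (\<omega> t)) = Ionescu_Tulcea.C K' M' 0 n (\<lambda>_. undefined)"
proof -
  interpret IT: Ionescu_Tulcea K M by (rule IT)
  interpret IT': Ionescu_Tulcea K' M' by (rule IT')
  let ?\<Phi> = "\<lambda>n \<omega>. \<lambda>t\<in>{0..<n}. f t (\<omega> t)"
  have \<Phi>: "?\<Phi> n \<in> PiM {0..<n} M \<rightarrow>\<^sub>M PiM {0..<n} M'" for n
    using f by (intro measurable_restrict measurable_PiM_component_rev) auto
  \<comment> \<open>\<open>eP n \<omega>\<close> is the law of the history \<open>\<omega>\<close>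
    extended by one draw, so this is the kernel hypothesis lifted from the new coordinate to the
    whole extended history.\<close>
  have eP: "distr (IT.eP n \<omega>) (PiM {0..<Suc n} M') (?\<Phi> (Suc n)) = IT'.eP n (?\<Phi> n \<omega>)"
    if \<omega>: "\<omega> \<in> space (PiM {0..<n} M)" for n \<omega>
  proof -
    have sets: "sets (K n \<omega>) = sets (M n)"
      using \<omega> by (rule IT.sets_P)
    have upd: "fun_upd \<omega> n \<in> K n \<omega> \<rightarrow>\<^sub>M PiM {0..<Suc n} M"
      using \<omega> by (subst measurable_cong_sets[OF sets refl])
        (auto intro!: measurable_fun_upd[where J="{0..<n}"])
    have upd': "fun_upd (?\<Phi> n \<omega>) n \<in> M' n \<rightarrow>\<^sub>M PiM {0..<Suc n} M'"
      using measurable_space[OF \<Phi> \<omega>] by (auto intro!: measurable_fun_upd[where J="{0..<n}"])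
    have fK: "f n \<in> K n \<omega> \<rightarrow>\<^sub>M M' n"
      using f by (subst measurable_cong_sets[OF sets refl])
    have "distr (IT.eP n \<omega>) (PiM {0..<Suc n} M') (?\<Phi> (Suc n)) =
        distr (K n \<omega>) (PiM {0..<Suc n} M') (?\<Phi> (Suc n) \<circ> fun_upd \<omega> n)"
      unfolding IT.eP_def by (rule distr_distr[OF \<Phi> upd])
    \<comment> \<open>Appending a value and then mapping is the same as mapping the history and then
      appending the mapped value.\<close>
    also have "?\<Phi> (Suc n) \<circ> fun_upd \<omega> n = fun_upd (?\<Phi> n \<omega>) n \<circ> f n"
      by (auto simp: fun_eq_iff restrict_def)
    also have "distr (K n \<omega>) (PiM {0..<Suc n} M') (fun_upd (?\<Phi> n \<omega>) n \<circ> f n) =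
        IT'.eP n (?\<Phi> n \<omega>)"
      unfolding IT'.eP_def K[OF \<omega>, symmetric] by (rule distr_distr[OF upd' fK, symmetric])
    finally show ?thesis .
  qed
  show ?thesis
  proof (induction n)
    \<comment> \<open>At horizon 0 both laws are Dirac measures at
      \<open>\<lambda>_. undefined\<close>, the only point of a product over the empty index
      set.\<close>
    case 0
    show ?case
      using \<Phi>[of 0] by (simp add: distr_return restrict_def)
  next
    case (Suc n)
    let ?C = "IT.C 0 n (\<lambda>_. undefined)"
    have u: "(\<lambda>_. undefined) \<in> space (PiM {0..<0} M)"
      by simp
    have sets: "sets ?C = sets (PiM {0..<n} M)" and space: "space ?C = space (PiM {0..<n} M)"
      using IT.sets_C[OF u, of n] IT.space_C[OF u, of n] by simp_all
    have ne: "space ?C \<noteq> {}"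
      using IT.prob_space_C[OF u] by (rule prob_space.not_empty)
    have \<Phi>C: "?\<Phi> n \<in> ?C \<rightarrow>\<^sub>M PiM {0..<n} M'"
      using \<Phi> by (subst measurable_cong_sets[OF sets refl])
    have ePC: "IT.eP n \<in> ?C \<rightarrow>\<^sub>M subprob_algebra (PiM {0..<Suc n} M)"
      using IT.measurable_eP by (subst measurable_cong_sets[OF sets refl])
    have "distr (IT.C 0 (Suc n) (\<lambda>_. undefined)) (PiM {0..<Suc n} M') (?\<Phi> (Suc n)) =
        distr (?C \<bind> IT.eP n) (PiM {0..<Suc n} M') (?\<Phi> (Suc n))"
      by simp
    \<comment> \<open>The pushforward is moved inside the bind, rewritten there by
      \<open>eP\<close>, and then taken out on the other side as a change of variables in
      \<open>?C\<close>, where the induction hypothesis applies.\<close>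
    also have "\<dots> = ?C \<bind> (\<lambda>\<omega>. distr (IT.eP n \<omega>) (PiM {0..<Suc n} M') (?\<Phi> (Suc n)))"
      by (rule distr_bind[OF ePC ne \<Phi>])
    also have "\<dots> = ?C \<bind> (\<lambda>\<omega>. IT'.eP n (?\<Phi> n \<omega>))"
      by (intro bind_cong refl eP) (simp add: space)
    also have "\<dots> = distr ?C (PiM {0..<n} M') (?\<Phi> n) \<bind> IT'.eP n"
      by (rule bind_distr[OF \<Phi>C IT'.measurable_eP ne, symmetric])
    also have "\<dots> = IT'.C 0 (Suc n) (\<lambda>_. undefined)"
      by (simp add: Suc)
    finally show ?case .
  qed
qed

text \<open>A finite measure on an infinite product is determined by its values on cylinders over
  finite index sets. Such a cylinder lies below some finite horizon, where the previous lemma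
  decides its measure.\<close>

lemma Ionescu_Tulcea_lim_distr:
  assumes IT: "Ionescu_Tulcea K M" and IT': "Ionescu_Tulcea K' M'"
    and f: "\<And>n. f n \<in> M n \<rightarrow>\<^sub>M M' n"
    and K: "\<And>n \<omega>. \<omega> \<in> space (PiM {0..<n} M) \<Longrightarrow>
      distr (K n \<omega>) (M' n) (f n) = K' n (\<lambda>t\<in>{0..<n}. f t (\<omega> t))"
  shows "distr (projective_family.lim UNIV (Ionescu_Tulcea.CI K M) M) (PiM UNIV M')
      (\<lambda>\<omega> t. f t (\<omega> t)) = projective_family.lim UNIV (Ionescu_Tulcea.CI K' M') M'"
proof -
  interpret IT: Ionescu_Tulcea K M by (rule IT)
  interpret IT': Ionescu_Tulcea K' M' by (rule IT')
  let ?D = "distr IT.PF.lim (PiM UNIV M') (\<lambda>\<omega> t. f t (\<omega> t))"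
  let ?\<Phi> = "\<lambda>J \<omega>. \<lambda>t\<in>J. f t (\<omega> t)"
  have \<Phi>: "?\<Phi> J \<in> PiM J M \<rightarrow>\<^sub>M PiM J M'" for J
    using f by (intro measurable_restrict measurable_PiM_component_rev) auto
  have \<Phi>lim: "(\<lambda>\<omega> t. f t (\<omega> t)) \<in> IT.PF.lim \<rightarrow>\<^sub>M PiM UNIV M'"
    using \<Phi>[of UNIV] by (simp add: measurable_cong_sets[OF IT.PF.sets_lim refl] restrict_UNIV)
  show ?thesis
  proof (rule measure_eqI_PiM_infinite)
    show "sets ?D = sets (PiM UNIV M')" "sets IT'.PF.lim = sets (PiM UNIV M')"
      by simp_all
    \<comment> \<open>The cylinder over the empty index set is the whole space, so its measure is
      the total mass. This yields the finiteness that uniqueness on cylinders requires.\<close>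
    have "emeasure IT.PF.lim (IT.PF.emb UNIV {} (space (PiM {} M))) = 1"
      using IT.lim[of "{}" "space (PiM {} M)"] prob_space.emeasure_space_1[OF IT.PF.prob_space_P[of "{}"]]
      by (simp add: IT.PF.space_P)
    then have "emeasure IT.PF.lim (space IT.PF.lim) = 1"
      by (simp add: prod_emb_def space_PiM restrict_def vimage_def)
    then have "prob_space IT.PF.lim"
      by (rule prob_spaceI)
    then interpret D: prob_space ?D
      using \<Phi>lim by (rule prob_space.prob_space_distr)
    show "finite_measure ?D"
      by (rule D.finite_measure_axioms)
  next
    fix A J assume J: "finite J" "J \<subseteq> UNIV" and A: "\<And>i. i \<in> J \<Longrightarrow> A i \<in> sets (M' i)"
    let ?X' = "Pi\<^sub>E J A" and ?X = "?\<Phi> J -` Pi\<^sub>E J A \<inter> space (PiM J M)"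
    have X': "?X' \<in> sets (PiM J M')"
      using J A by (intro sets_PiM_I_finite) auto
    have X: "?X \<in> sets (PiM J M)"
      by (rule measurable_sets[OF \<Phi> X'])
    obtain n where n: "J \<subseteq> {0..<n}"
      using IT.up_to[OF J(1)] by blast
    let ?C = "IT.C 0 n (\<lambda>_. undefined)"
    have u: "(\<lambda>_. undefined) \<in> space (PiM {0..<0} M)"
      by simp
    have sets: "sets ?C = sets (PiM {0..<n} M)" and space: "space ?C = space (PiM {0..<n} M)"
      using IT.sets_C[OF u, of n] IT.space_C[OF u, of n] by simp_all
    have \<Phi>C: "?\<Phi> {0..<n} \<in> ?C \<rightarrow>\<^sub>M PiM {0..<n} M'"
      using \<Phi> by (subst measurable_cong_sets[OF sets refl])
    have fsp: "f i y \<in> space (M' i)" if "y \<in> space (M i)" for i y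
      using measurable_space[OF f that] .
    have "emeasure ?D (IT'.PF.emb UNIV J ?X') =
        emeasure IT.PF.lim ((\<lambda>\<omega> t. f t (\<omega> t)) -` IT'.PF.emb UNIV J ?X' \<inter> space IT.PF.lim)"
      using J X' by (intro emeasure_distr \<Phi>lim measurable_prod_emb) auto
    \<comment> \<open>Because the map acts coordinatewise, the preimage of a cylinder is a cylinder
      over the same \<open>J\<close>. The other coordinates impose no constraint, since
      \<open>f t\<close> maps \<open>space (M t)\<close> into \<open>space (M' t)\<close>.\<close>
    also have "(\<lambda>\<omega> t. f t (\<omega> t)) -` IT'.PF.emb UNIV J ?X' \<inter> space IT.PF.lim = IT.PF.emb UNIV J ?X"
      using fsp by (auto simp: prod_emb_def space_PiM PiE_iff)
    also have "emeasure IT.PF.lim \<dots> = emeasure ?C (IT.PF.emb {0..<n} J ?X)"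
      using IT.lim[OF J(1) X] IT.emeasure_CI[OF n X] by simp
    \<comment> \<open>The same computation, now at horizon \<open>n\<close>, presents the set as a
      preimage under the finite-horizon map.\<close>
    also have "IT.PF.emb {0..<n} J ?X = ?\<Phi> {0..<n} -` IT'.PF.emb {0..<n} J ?X' \<inter> space ?C"
      unfolding space using fsp n
      by (auto simp: prod_emb_def space_PiM PiE_iff extensional_def subset_eq)
    also have "emeasure ?C \<dots> = emeasure (distr ?C (PiM {0..<n} M') (?\<Phi> {0..<n})) (IT'.PF.emb {0..<n} J ?X')"
      using n X' by (intro emeasure_distr[symmetric] \<Phi>C measurable_prod_emb) auto
    also have "distr ?C (PiM {0..<n} M') (?\<Phi> {0..<n}) = IT'.C 0 n (\<lambda>_. undefined)"
      by (intro Ionescu_Tulcea_C_distr IT IT' f K)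
    also have "emeasure \<dots> (IT'.PF.emb {0..<n} J ?X') = emeasure IT'.PF.lim (IT'.PF.emb UNIV J ?X')"
      using IT'.lim[OF J(1) X'] IT'.emeasure_CI[OF n X'] by simp
    finally show "emeasure ?D (IT'.PF.emb UNIV J ?X') = emeasure IT'.PF.lim (IT'.PF.emb UNIV J ?X')" .
  qed
qed

section \<open>Trajectory laws and projections of Markov processes\<close>

lemma sets_trajectory:
  assumes "P \<in> S \<Otimes>\<^sub>M A \<rightarrow>\<^sub>M prob_algebra S" "\<pi> \<in> S \<rightarrow>\<^sub>M prob_algebra A" "x \<in> space (S \<Otimes>\<^sub>M A)"
  shows "sets (trajectory S A P \<pi> x) = sets (PiM UNIV (\<lambda>_. S \<Otimes>\<^sub>M A))"
proof -
  interpret Ionescu_Tulcea "history_kernel S A P \<pi> x" "\<lambda>_. S \<Otimes>\<^sub>M A"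
    by (rule Ionescu_Tulcea_history_kernel[OF assms])
  show ?thesis
    by (simp add: trajectory_def)
qed

text \<open>A lumping principle: history kernels look only at the last state-action pair, so
  intertwining of the one-step kernels already gives the kernel hypothesis for all histories. At
  time 0 a Dirac measure is mapped to a Dirac measure.\<close>

lemma trajectory_distr:
  assumes "P \<in> S \<Otimes>\<^sub>M A \<rightarrow>\<^sub>M prob_algebra S" "\<pi> \<in> S \<rightarrow>\<^sub>M prob_algebra A"
    and "P' \<in> S' \<Otimes>\<^sub>M A' \<rightarrow>\<^sub>M prob_algebra S'" "\<pi>' \<in> S' \<rightarrow>\<^sub>M prob_algebra A'"
    and f: "f \<in> S \<Otimes>\<^sub>M A \<rightarrow>\<^sub>M S' \<Otimes>\<^sub>M A'" and x: "x \<in> space (S \<Otimes>\<^sub>M A)"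
    and step: "\<And>y. y \<in> space (S \<Otimes>\<^sub>M A) \<Longrightarrow>
      distr (step_kernel S A P \<pi> y) (S' \<Otimes>\<^sub>M A') f = step_kernel S' A' P' \<pi>' (f y)"
  shows "distr (trajectory S A P \<pi> x) (PiM UNIV (\<lambda>_. S' \<Otimes>\<^sub>M A')) (\<lambda>\<omega> t. f (\<omega> t)) =
    trajectory S' A' P' \<pi>' (f x)"
  unfolding trajectory_def
proof (rule Ionescu_Tulcea_lim_distr)
  show "Ionescu_Tulcea (history_kernel S A P \<pi> x) (\<lambda>_. S \<Otimes>\<^sub>M A)"
    by (rule Ionescu_Tulcea_history_kernel) fact+
  show "Ionescu_Tulcea (history_kernel S' A' P' \<pi>' (f x)) (\<lambda>_. S' \<Otimes>\<^sub>M A')"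
    using measurable_space[OF f x] by (rule Ionescu_Tulcea_history_kernel[OF assms(3,4)])
  show "f \<in> S \<Otimes>\<^sub>M A \<rightarrow>\<^sub>M S' \<Otimes>\<^sub>M A'"
    by (rule f)
  fix n :: nat and \<omega> assume \<omega>: "\<omega> \<in> space (PiM {0..<n} (\<lambda>_. S \<Otimes>\<^sub>M A))"
  show "distr (history_kernel S A P \<pi> x n \<omega>) (S' \<Otimes>\<^sub>M A') f =
      history_kernel S' A' P' \<pi>' (f x) n (\<lambda>t\<in>{0..<n}. f (\<omega> t))"
  proof (cases n)
    case 0
    then show ?thesis
      by (simp add: history_kernel_def distr_return[OF f x])
  next
    case (Suc m)
    \<comment> \<open>\<open>m\<close> is the last index of \<open>{0..<Suc m}\<close>, so
      restricting the mapped history to that range leaves \<open>f (\<omega> m)\<close>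
      intact.\<close>
    then have "\<omega> m \<in> space (S \<Otimes>\<^sub>M A)"
      using \<omega> by (auto simp: space_PiM PiE_iff)
    with Suc show ?thesis
      by (simp add: history_kernel_def step)
  qed
qed

section \<open>The joint policy and the projection of one joint step to an agent\<close>

text \<open>Measurability of a probability kernel can be tested on an intersection-stable generator.
  On cylinders the product measure is a finite product of the agents' probabilities, each measurable
  in \<open>s\<close>.\<close>

lemma measurable_joint_policy:
  assumes \<pi>: "\<And>i. i \<in> {1..N} \<Longrightarrow> \<pi> i \<in> S i \<rightarrow>\<^sub>M prob_algebra (A i)"
  shows "joint_policy N \<pi> \<in> joint_space N S \<rightarrow>\<^sub>M prob_algebra (joint_space N A)"
proof (rule measurable_prob_algebra_generated[OF sets_PiM Int_stable_prod_algebra prod_algebra_sets_into_space])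
  fix s assume "s \<in> space (joint_space N S)"
  then have *: "\<pi> i (s i) \<in> space (prob_algebra (A i))" if "i \<in> {1..N}" for i
    using measurable_space[OF \<pi>[OF that], of "s i"] that by (auto simp: space_PiM PiE_iff)
  then show "prob_space (joint_policy N \<pi> s)"
    unfolding joint_policy_def by (intro prob_space_PiM) (auto simp: space_prob_algebra)
  show "sets (joint_policy N \<pi> s) = sets (joint_space N A)"
    unfolding joint_policy_def using * by (intro sets_PiM_cong) (auto simp: space_prob_algebra)
next
  fix X assume "X \<in> prod_algebra {1..N} A"
  then obtain J E where X: "X = prod_emb {1..N} A J (Pi\<^sub>E J E)" and J: "finite J" "J \<subseteq> {1..N}"
    and E: "\<And>i. i \<in> J \<Longrightarrow> E i \<in> sets (A i)"
    by (rule prod_algebraE) blast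
  have "emeasure (joint_policy N \<pi> s) X = (\<Prod>i\<in>J. emeasure (\<pi> i (s i)) (E i))"
    if s: "s \<in> space (joint_space N S)" for s
  proof -
    have *: "sets (\<pi> i (s i)) = sets (A i)" "prob_space (\<pi> i (s i))" if "i \<in> {1..N}" for i
      using measurable_space[OF \<pi>[OF that], of "s i"] that s
      by (auto simp: space_PiM PiE_iff space_prob_algebra)
    \<comment> \<open>An embedding depends only on the underlying spaces, so \<open>A i\<close> may
      be exchanged for \<open>\<pi> i (s i)\<close>; this is the form in which the product measure
      can be evaluated.\<close>
    have "X = prod_emb {1..N} (\<lambda>i. \<pi> i (s i)) J (Pi\<^sub>E J E)"
      unfolding X prod_emb_def using *(1)[THEN sets_eq_imp_space_eq] by (auto simp: PiE_iff)
    then show ?thesis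
      unfolding joint_policy_def using * J E by (auto intro!: emeasure_PiM_emb)
  qed
  moreover have "(\<lambda>s. \<Prod>i\<in>J. emeasure (\<pi> i (s i)) (E i)) \<in> borel_measurable (joint_space N S)"
  proof (intro borel_measurable_prod_ennreal)
    fix i assume i: "i \<in> J"
    then have "(\<lambda>s. \<pi> i (s i)) \<in> joint_space N S \<rightarrow>\<^sub>M prob_algebra (A i)"
      using J by (intro measurable_PiM_component_rev \<pi>) auto
    then show "(\<lambda>s. emeasure (\<pi> i (s i)) (E i)) \<in> borel_measurable (joint_space N S)"
      using E[OF i] by (intro measurable_compose[OF measurable_prob_algebraD measurable_emeasure_subprob_algebra])
  qed
  ultimately show "(\<lambda>s. emeasure (joint_policy N \<pi> s) X) \<in> borel_measurable (joint_space N S)"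
    by (subst measurable_cong) auto
qed

text \<open>One step has two stages. The \<open>i\<close>-th component of the next state has law
  \<open>P\<^sub>i\<close> by \<open>agent_transition\<close>; given the next joint state, the
  \<open>i\<close>-th marginal of the product policy is \<open>\<pi> i\<close> at that component
  alone. Composing the two gives the agent's own step.\<close>

lemma distr_step_kernel_agent:
  assumes P: "P \<in> joint_space N S \<Otimes>\<^sub>M joint_space N A \<rightarrow>\<^sub>M prob_algebra (joint_space N S)"
    and \<pi>: "\<And>i. i \<in> {1..N} \<Longrightarrow> \<pi> i \<in> S i \<rightarrow>\<^sub>M prob_algebra (A i)"
    and i: "i \<in> {1..N}" and Pi: "agent_transition N S A P i P\<^sub>i"
    and y: "y \<in> space (joint_space N S \<Otimes>\<^sub>M joint_space N A)"
  shows "distr (step_kernel (joint_space N S) (joint_space N A) P (joint_policy N \<pi>) y)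
      (S i \<Otimes>\<^sub>M A i) (\<lambda>(s, a). (s i, a i)) = step_kernel (S i) (A i) P\<^sub>i (\<pi> i) (fst y i, snd y i)"
proof -
  let ?S = "joint_space N S" and ?A = "joint_space N A" and ?\<pi> = "joint_policy N \<pi>"
  note [measurable] = P measurable_joint_policy[of N \<pi> S A, OF \<pi>] \<pi>[OF i]
  have Si[measurable]: "(\<lambda>s. s i) \<in> ?S \<rightarrow>\<^sub>M S i" and Ai[measurable]: "(\<lambda>a. a i) \<in> ?A \<rightarrow>\<^sub>M A i"
    using i by (auto intro: measurable_component_singleton)
  have g: "(\<lambda>(s, a). (s i, a i)) \<in> ?S \<Otimes>\<^sub>M ?A \<rightarrow>\<^sub>M S i \<Otimes>\<^sub>M A i"
    by measurable
  have Py: "P y \<in> space (prob_algebra ?S)"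
    using measurable_space[OF P y] .
  then have setsPy: "sets (P y) = sets ?S" and neP: "space (P y) \<noteq> {}"
    by (auto simp: space_prob_algebra prob_space.not_empty)
  have inner: "distr (?\<pi> s \<bind> (\<lambda>a. return (?S \<Otimes>\<^sub>M ?A) (s, a))) (S i \<Otimes>\<^sub>M A i) (\<lambda>(s, a). (s i, a i)) =
      \<pi> i (s i) \<bind> (\<lambda>a. return (S i \<Otimes>\<^sub>M A i) (s i, a))" if s: "s \<in> space ?S" for s
  proof -
    have "?\<pi> s \<in> space (prob_algebra ?A)"
      using measurable_space[OF measurable_joint_policy[of N \<pi> S A, OF \<pi>] s] .
    then have sets: "sets (?\<pi> s) = sets ?A" and ne: "space (?\<pi> s) \<noteq> {}"
      by (auto simp: space_prob_algebra prob_space.not_empty)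
    have pi_s: "sets (\<pi> j (s j)) = sets (A j)" "prob_space (\<pi> j (s j))" if "j \<in> {1..N}" for j
      using measurable_space[OF \<pi>[OF that], of "s j"] that s
      by (auto simp: space_PiM PiE_iff space_prob_algebra)
    have marg: "distr (?\<pi> s) (A i) (\<lambda>a. a i) = \<pi> i (s i)"
    proof -
      \<comment> \<open>The marginal of a product measure is stated with the factor itself as
        target, so the target is first replaced by \<open>\<pi> i (s i)\<close>, which has the same
        measurable sets.\<close>
      have "distr (?\<pi> s) (A i) (\<lambda>a. a i) = distr (?\<pi> s) (\<pi> i (s i)) (\<lambda>a. a i)"
        using pi_s(1)[OF i] by (intro distr_cong) auto
      also have "\<dots> = \<pi> i (s i)"
        unfolding joint_policy_def using pi_s(2) i by (rule distr_PiM_component)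
      finally show ?thesis .
    qed
    have si: "s i \<in> space (S i)"
      using measurable_space[OF Si s] .
    have Ai': "(\<lambda>a. a i) \<in> ?\<pi> s \<rightarrow>\<^sub>M A i"
      using Ai by (subst measurable_cong_sets[OF sets refl])
    have pair: "(\<lambda>a. (s, a)) \<in> ?\<pi> s \<rightarrow>\<^sub>M ?S \<Otimes>\<^sub>M ?A"
      using s by (subst measurable_cong_sets[OF sets refl]) simp
    have r: "(\<lambda>a. return (S i \<Otimes>\<^sub>M A i) (s i, a)) \<in> A i \<rightarrow>\<^sub>M subprob_algebra (S i \<Otimes>\<^sub>M A i)"
      using si by measurable
    have "distr (?\<pi> s \<bind> (\<lambda>a. return (?S \<Otimes>\<^sub>M ?A) (s, a))) (S i \<Otimes>\<^sub>M A i) (\<lambda>(s, a). (s i, a i)) =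
        ?\<pi> s \<bind> (\<lambda>a. distr (return (?S \<Otimes>\<^sub>M ?A) (s, a)) (S i \<Otimes>\<^sub>M A i) (\<lambda>(s, a). (s i, a i)))"
      by (rule distr_bind[OF measurable_compose[OF pair return_measurable] ne g])
    also have "\<dots> = ?\<pi> s \<bind> (\<lambda>a. return (S i \<Otimes>\<^sub>M A i) (s i, a i))"
      using s sets_eq_imp_space_eq[OF sets]
      by (intro bind_cong refl) (simp add: distr_return[OF g] space_pair_measure del: One_nat_def)
    also have "\<dots> = distr (?\<pi> s) (A i) (\<lambda>a. a i) \<bind> (\<lambda>a. return (S i \<Otimes>\<^sub>M A i) (s i, a))"
      by (rule bind_distr[OF Ai' r ne, symmetric])
    finally show ?thesis
      by (simp add: marg)
  qed
  have k: "(\<lambda>s. ?\<pi> s \<bind> (\<lambda>a. return (?S \<Otimes>\<^sub>M ?A) (s, a))) \<in> P y \<rightarrow>\<^sub>M subprob_algebra (?S \<Otimes>\<^sub>M ?A)"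
    by (subst measurable_cong_sets[OF setsPy refl], rule measurable_prob_algebraD) measurable
  have k': "(\<lambda>s. \<pi> i s \<bind> (\<lambda>a. return (S i \<Otimes>\<^sub>M A i) (s, a))) \<in> S i \<rightarrow>\<^sub>M subprob_algebra (S i \<Otimes>\<^sub>M A i)"
    by (rule measurable_prob_algebraD) measurable
  have Si': "(\<lambda>s. s i) \<in> P y \<rightarrow>\<^sub>M S i"
    using Si by (subst measurable_cong_sets[OF setsPy refl])
  have "distr (step_kernel ?S ?A P ?\<pi> y) (S i \<Otimes>\<^sub>M A i) (\<lambda>(s, a). (s i, a i)) =
      P y \<bind> (\<lambda>s. distr (?\<pi> s \<bind> (\<lambda>a. return (?S \<Otimes>\<^sub>M ?A) (s, a))) (S i \<Otimes>\<^sub>M A i) (\<lambda>(s, a). (s i, a i)))"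
    unfolding step_kernel_def by (rule distr_bind[OF k neP g])
  also have "\<dots> = P y \<bind> (\<lambda>s. \<pi> i (s i) \<bind> (\<lambda>a. return (S i \<Otimes>\<^sub>M A i) (s i, a)))"
    using sets_eq_imp_space_eq[OF setsPy] by (intro bind_cong refl inner) simp
  \<comment> \<open>After projection the inner kernel depends on the next joint state only through
    its \<open>i\<close>-th component, so the bind descends to that marginal of
    \<open>P y\<close>.\<close>
  also have "\<dots> = distr (P y) (S i) (\<lambda>s. s i) \<bind> (\<lambda>s. \<pi> i s \<bind> (\<lambda>a. return (S i \<Otimes>\<^sub>M A i) (s, a)))"
    by (rule bind_distr[OF Si' k' neP, symmetric])
  also have "distr (P y) (S i) (\<lambda>s. s i) = P\<^sub>i (fst y i, snd y i)"
    using Pi y by (auto simp: agent_transition_def space_pair_measure)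
  finally show ?thesis
    by (simp add: step_kernel_def)
qed

section \<open>Integrability of discounted returns\<close>

text \<open>Extracts from \<open>Q_well_defined\<close> the two facts behind linearity:
  integrability permits splitting the expectation, and almost sure summability permits splitting the
  infinite series.\<close>

lemma discounted_return_integrable:
  assumes \<gamma>: "0 \<le> \<gamma>" and r: "r \<in> borel_measurable (S \<Otimes>\<^sub>M A)"
    and sets: "sets (trajectory S A P \<pi> x) = sets (PiM UNIV (\<lambda>_. S \<Otimes>\<^sub>M A))"
    and Q: "Q_well_defined S A P \<pi> \<gamma> r x"
  shows "integrable (trajectory S A P \<pi> x) (\<lambda>\<omega>. \<Sum>t. \<gamma> ^ t * r (\<omega> t))" (is ?int)
    and "AE \<omega> in trajectory S A P \<pi> x. summable (\<lambda>t. \<gamma> ^ t * r (\<omega> t))" (is ?summable)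
proof -
  let ?T = "trajectory S A P \<pi> x"
  have [measurable]: "(\<lambda>\<omega>. r (\<omega> t)) \<in> borel_measurable ?T" for t
    by (subst measurable_cong_sets[OF sets refl])
      (intro measurable_PiM_component_rev r, simp)
  have fin: "(\<integral>\<^sup>+\<omega>. (\<Sum>t. ennreal (\<gamma> ^ t * \<bar>r (\<omega> t)\<bar>)) \<partial>?T) < \<infinity>"
    using Q by (simp add: Q_well_defined_def)
  have "AE \<omega> in ?T. (\<Sum>t. ennreal (\<gamma> ^ t * \<bar>r (\<omega> t)\<bar>)) \<noteq> \<infinity>"
    using fin by (intro nn_integral_PInf_AE) auto
  \<comment> \<open>A function with finite nonnegative integral is finite almost everywhere, and a
    finite extended sum of absolute values is absolute summability of the real series.\<close>
  then have AE: "AE \<omega> in ?T. summable (\<lambda>t. \<bar>\<gamma> ^ t * r (\<omega> t)\<bar>)"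
  proof eventually_elim
    case (elim \<omega>)
    then have "summable (\<lambda>t. \<gamma> ^ t * \<bar>r (\<omega> t)\<bar>)"
      using \<gamma> by (intro summable_suminf_not_top) (auto simp: top_ennreal_def[symmetric])
    then show ?case
      using \<gamma> by (simp add: abs_mult)
  qed
  then show ?summable
    by eventually_elim (rule summable_rabs_cancel)
  \<comment> \<open>The triangle inequality for series dominates the return by the sum of absolute
    values, whose integral is finite.\<close>
  have "(\<integral>\<^sup>+\<omega>. norm (\<Sum>t. \<gamma> ^ t * r (\<omega> t)) \<partial>?T) \<le> (\<integral>\<^sup>+\<omega>. (\<Sum>t. ennreal (\<gamma> ^ t * \<bar>r (\<omega> t)\<bar>)) \<partial>?T)"
  proof (rule nn_integral_mono_AE, use AE in eventually_elim)
    case (elim \<omega>)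
    have "ennreal (norm (\<Sum>t. \<gamma> ^ t * r (\<omega> t))) \<le> ennreal (\<Sum>t. \<bar>\<gamma> ^ t * r (\<omega> t)\<bar>)"
      using summable_rabs[OF elim] by (auto intro: ennreal_leI)
    also have "\<dots> = (\<Sum>t. ennreal \<bar>\<gamma> ^ t * r (\<omega> t)\<bar>)"
      using elim by (intro suminf_ennreal2[symmetric]) auto
    finally show ?case
      using \<gamma> by (simp add: abs_mult)
  qed
  then show ?int
    using fin by (intro integrableI_bounded) (auto intro: le_less_trans)
qed

section \<open>Decomposition of the joint Q-value\<close>

theorem theorem1:
  fixes N C :: nat
    and S :: "nat \<Rightarrow> 's measure"
    and A :: "nat \<Rightarrow> 'a measure"
    and P :: "(nat \<Rightarrow> 's) \<times> (nat \<Rightarrow> 'a) \<Rightarrow> (nat \<Rightarrow> 's) measure"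
    and r :: "(nat \<Rightarrow> 's) \<times> (nat \<Rightarrow> 'a) \<Rightarrow> real"
    and \<gamma> :: real
    and d\<^sub>0 :: "(nat \<Rightarrow> 's) measure"
    and \<pi> :: "nat \<Rightarrow> 's \<Rightarrow> 'a measure"
    and P_ind :: "nat \<Rightarrow> 's \<times> 'a \<Rightarrow> 's measure"
    and r_ind :: "nat \<Rightarrow> 's \<times> 'a \<Rightarrow> real"
    and r_comp :: "nat \<Rightarrow> nat \<Rightarrow> 's \<times> 'a \<Rightarrow> real"
    and \<sigma> :: "nat \<Rightarrow> nat \<Rightarrow> real"
    and s :: "nat \<Rightarrow> 's"
    and a :: "nat \<Rightarrow> 'a"
  assumes game: "markov_game N S A P r \<gamma> d\<^sub>0"
    and policy: "\<And>i. i \<in> {1..N} \<Longrightarrow> \<pi> i \<in> S i \<rightarrow>\<^sub>M prob_algebra (A i)"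
    and P_ind: "\<And>i. i \<in> {1..N} \<Longrightarrow> agent_transition N S A P i (P_ind i)"
    and weights: "\<And>c i. c \<in> {1..C} \<Longrightarrow> i \<in> {1..N} \<Longrightarrow> \<sigma> c i \<in> {0..1}"
    and weights_sum: "\<And>i. i \<in> {1..N} \<Longrightarrow> (\<Sum>c=1..C. \<sigma> c i) = 1"
    and r_comp: "\<And>c i. c \<in> {1..C} \<Longrightarrow> i \<in> {1..N} \<Longrightarrow>
        r_comp c i \<in> borel_measurable (S i \<Otimes>\<^sub>M A i)"
    and r_ind: "\<And>i x. i \<in> {1..N} \<Longrightarrow> x \<in> space (S i \<Otimes>\<^sub>M A i) \<Longrightarrow>
        r_ind i x = (\<Sum>c=1..C. \<sigma> c i * r_comp c i x)"
    and r_team: "\<And>s a. s \<in> space (joint_space N S) \<Longrightarrow> a \<in> space (joint_space N A) \<Longrightarrow>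
        r (s, a) = (\<Sum>i=1..N. r_ind i (s i, a i))"
    and Q_comp: "\<And>c i x. c \<in> {1..C} \<Longrightarrow> i \<in> {1..N} \<Longrightarrow> x \<in> space (S i \<Otimes>\<^sub>M A i) \<Longrightarrow>
        Q_well_defined (S i) (A i) (P_ind i) (\<pi> i) \<gamma> (r_comp c i) x"
    and s: "s \<in> space (joint_space N S)"
    and a: "a \<in> space (joint_space N A)"
  shows "Q_value (joint_space N S) (joint_space N A) P (joint_policy N \<pi>) \<gamma> r (s, a) =
    (\<Sum>i=1..N. \<Sum>c=1..C. \<sigma> c i *
      Q_value (S i) (A i) (P_ind i) (\<pi> i) \<gamma> (r_comp c i) (s i, a i))"
proof -
  let ?S = "joint_space N S" and ?A = "joint_space N A" and ?\<pi> = "joint_policy N \<pi>"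
  let ?T = "trajectory ?S ?A P ?\<pi> (s, a)"
  let ?T' = "\<lambda>i. trajectory (S i) (A i) (P_ind i) (\<pi> i) (s i, a i)"
  let ?G = "\<lambda>c i \<omega>. \<Sum>t. \<gamma> ^ t * r_comp c i (\<omega> t)"
  define \<phi> :: "nat \<Rightarrow> (nat \<Rightarrow> 's) \<times> (nat \<Rightarrow> 'a) \<Rightarrow> 's \<times> 'a" where "\<phi> i = (\<lambda>(s, a). (s i, a i))" for i
  let ?\<Phi> = "\<lambda>i \<omega> t. \<phi> i (\<omega> t)"
  interpret markov_game N S A P r \<gamma> d\<^sub>0
    by (rule game)
  note policy' = measurable_joint_policy[of N \<pi> S A, OF policy]
  have sa: "(s, a) \<in> space (?S \<Otimes>\<^sub>M ?A)"
    using s a by (simp add: space_pair_measure)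
  have \<phi>: "\<phi> i \<in> ?S \<Otimes>\<^sub>M ?A \<rightarrow>\<^sub>M S i \<Otimes>\<^sub>M A i" if i: "i \<in> {1..N}" for i
  proof -
    have [measurable]: "(\<lambda>s. s i) \<in> ?S \<rightarrow>\<^sub>M S i" "(\<lambda>a. a i) \<in> ?A \<rightarrow>\<^sub>M A i"
      using i by (auto intro: measurable_component_singleton)
    show ?thesis
      unfolding \<phi>_def by measurable
  qed
  have sets_T: "sets ?T = sets (PiM UNIV (\<lambda>_. ?S \<Otimes>\<^sub>M ?A))"
    by (rule sets_trajectory[OF transition policy' sa])
  have transition_i: "P_ind i \<in> S i \<Otimes>\<^sub>M A i \<rightarrow>\<^sub>M prob_algebra (S i)" if "i \<in> {1..N}" for i
    using P_ind[OF that] by (simp add: agent_transition_def)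
  have sa_i: "(s i, a i) \<in> space (S i \<Otimes>\<^sub>M A i)" if "i \<in> {1..N}" for i
    using measurable_space[OF \<phi>[OF that] sa] by (simp add: \<phi>_def)
  have sets_T': "sets (?T' i) = sets (PiM UNIV (\<lambda>_. S i \<Otimes>\<^sub>M A i))" if "i \<in> {1..N}" for i
    by (rule sets_trajectory[OF transition_i[OF that] policy[OF that] sa_i[OF that]])
  have distr_T: "distr ?T (PiM UNIV (\<lambda>_. S i \<Otimes>\<^sub>M A i)) (?\<Phi> i) = ?T' i" if i: "i \<in> {1..N}" for i
  proof -
    have "distr ?T (PiM UNIV (\<lambda>_. S i \<Otimes>\<^sub>M A i)) (?\<Phi> i) =
        trajectory (S i) (A i) (P_ind i) (\<pi> i) (\<phi> i (s, a))"
      using distr_step_kernel_agent[OF transition policy i P_ind[OF i]]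
      by (intro trajectory_distr[OF transition policy' transition_i[OF i] policy[OF i] \<phi>[OF i] sa])
        (auto simp: \<phi>_def split_beta)
    then show ?thesis
      by (simp add: \<phi>_def)
  qed
  have \<Phi>: "?\<Phi> i \<in> ?T \<rightarrow>\<^sub>M PiM UNIV (\<lambda>_. S i \<Otimes>\<^sub>M A i)" if "i \<in> {1..N}" for i
  proof (subst measurable_cong_sets[OF sets_T refl], rule measurable_PiM_single')
    show "(\<lambda>\<omega>. \<phi> i (\<omega> t)) \<in> PiM UNIV (\<lambda>_. ?S \<Otimes>\<^sub>M ?A) \<rightarrow>\<^sub>M S i \<Otimes>\<^sub>M A i" for t
      using \<phi>[OF that] by (intro measurable_PiM_component_rev) auto
    show "?\<Phi> i \<in> space (PiM UNIV (\<lambda>_. ?S \<Otimes>\<^sub>M ?A)) \<rightarrow> (\<Pi>\<^sub>E t\<in>UNIV. space (S i \<Otimes>\<^sub>M A i))"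
      using measurable_space[OF \<phi>[OF that]] by (auto simp: space_PiM PiE_iff simp del: split_paired_All)
  qed
  \<comment> \<open>Integrability, summability and expectation are pulled back along the projection,
    so that the returns of all agents become random variables on the one probability space
    \<open>?T\<close> and can be added.\<close>
  have int: "integrable ?T (\<lambda>\<omega>. ?G c i (?\<Phi> i \<omega>))"
    and summable: "AE \<omega> in ?T. summable (\<lambda>t. \<gamma> ^ t * r_comp c i (\<phi> i (\<omega> t)))"
    and Q: "(\<integral>\<omega>. ?G c i (?\<Phi> i \<omega>) \<partial>?T) = Q_value (S i) (A i) (P_ind i) (\<pi> i) \<gamma> (r_comp c i) (s i, a i)"
    if c: "c \<in> {1..C}" and i: "i \<in> {1..N}" for c i
  proof -
    note R = discounted_return_integrable[OF discount(1) r_comp[OF c i] sets_T'[OF i] Q_comp[OF c i sa_i[OF i]]]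
    \<comment> \<open>The change of variables asks for measurability on the target product space;
      the agent's trajectory law has exactly these measurable sets.\<close>
    have G: "?G c i \<in> borel_measurable (PiM UNIV (\<lambda>_. S i \<Otimes>\<^sub>M A i))"
      using borel_measurable_integrable[OF R(1)] by (simp add: measurable_cong_sets[OF sets_T'[OF i] refl])
    show "integrable ?T (\<lambda>\<omega>. ?G c i (?\<Phi> i \<omega>))"
      using R(1) unfolding distr_T[OF i, symmetric] by (rule integrable_distr[OF \<Phi>[OF i]])
    show "AE \<omega> in ?T. summable (\<lambda>t. \<gamma> ^ t * r_comp c i (\<phi> i (\<omega> t)))"
      using R(2) unfolding distr_T[OF i, symmetric] by (rule AE_distrD[OF \<Phi>[OF i]])
    show "(\<integral>\<omega>. ?G c i (?\<Phi> i \<omega>) \<partial>?T) = Q_value (S i) (A i) (P_ind i) (\<pi> i) \<gamma> (r_comp c i) (s i, a i)"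
      unfolding Q_value_def distr_T[OF i, symmetric] by (rule integral_distr[OF \<Phi>[OF i] G, symmetric])
  qed
  have r_eq: "r y = (\<Sum>i=1..N. \<Sum>c=1..C. \<sigma> c i * r_comp c i (\<phi> i y))" if y_in: "y \<in> space (?S \<Otimes>\<^sub>M ?A)" for y
  proof -
    obtain s' a' where y: "y = (s', a')" "s' \<in> space ?S" "a' \<in> space ?A"
      using y_in unfolding space_pair_measure by blast
    have "r y = (\<Sum>i=1..N. r_ind i (\<phi> i y))"
      using r_team[OF y(2,3)] by (simp add: y(1) \<phi>_def)
    also have "\<dots> = (\<Sum>i=1..N. \<Sum>c=1..C. \<sigma> c i * r_comp c i (\<phi> i y))"
      using measurable_space[OF \<phi> y_in] by (intro sum.cong refl r_ind) auto
    finally show ?thesis .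
  qed
  \<comment> \<open>There are finitely many pairs of agent and component, so their exceptional null
    sets can be merged.\<close>
  have "AE \<omega> in ?T. \<forall>i\<in>{1..N}. \<forall>c\<in>{1..C}. summable (\<lambda>t. \<gamma> ^ t * r_comp c i (\<phi> i (\<omega> t)))"
    using summable by (intro AE_finite_allI) auto
  \<comment> \<open>\<open>r_eq\<close> holds only for points of the joint space, hence the
    restriction to trajectories that stay in it.\<close>
  moreover have "AE \<omega> in ?T. \<omega> \<in> space ?T"
    by (rule AE_space)
  ultimately have AE: "AE \<omega> in ?T. (\<Sum>t. \<gamma> ^ t * r (\<omega> t)) = (\<Sum>i=1..N. \<Sum>c=1..C. \<sigma> c i * ?G c i (?\<Phi> i \<omega>))"
  proof eventually_elim
    case (elim \<omega>)
    have "\<omega> t \<in> space (?S \<Otimes>\<^sub>M ?A)" for t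
      using elim(2) sets_eq_imp_space_eq[OF sets_T] by (auto simp: space_PiM PiE_iff)
    then have "\<gamma> ^ t * r (\<omega> t) = (\<Sum>i=1..N. \<Sum>c=1..C. \<sigma> c i * (\<gamma> ^ t * r_comp c i (\<phi> i (\<omega> t))))" for t
      by (simp add: r_eq sum_distrib_left mult.left_commute)
    \<comment> \<open>The series over time is exchanged with the finite sums, which is legitimate
      because every component series converges for this \<open>\<omega>\<close>.\<close>
    moreover have "(\<lambda>t. \<Sum>i=1..N. \<Sum>c=1..C. \<sigma> c i * (\<gamma> ^ t * r_comp c i (\<phi> i (\<omega> t)))) sums
        (\<Sum>i=1..N. \<Sum>c=1..C. \<sigma> c i * ?G c i (?\<Phi> i \<omega>))"
      using elim(1) by (intro sums_sum sums_mult summable_sums) auto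
    ultimately show ?case
      by (simp add: sums_iff)
  qed
  have "Q_value ?S ?A P ?\<pi> \<gamma> r (s, a) = (\<integral>\<omega>. (\<Sum>i=1..N. \<Sum>c=1..C. \<sigma> c i * ?G c i (?\<Phi> i \<omega>)) \<partial>?T)"
    unfolding Q_value_def
  proof (rule integral_cong_AE[OF _ _ AE])
    have [measurable]: "(\<lambda>\<omega>. r (\<omega> t)) \<in> borel_measurable ?T" for t
      by (subst measurable_cong_sets[OF sets_T refl])
        (intro measurable_PiM_component_rev team_reward, simp)
    show "(\<lambda>\<omega>. \<Sum>t. \<gamma> ^ t * r (\<omega> t)) \<in> borel_measurable ?T"
      by measurable
    show "(\<lambda>\<omega>. \<Sum>i=1..N. \<Sum>c=1..C. \<sigma> c i * ?G c i (?\<Phi> i \<omega>)) \<in> borel_measurable ?T"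
      using int by (intro borel_measurable_sum borel_measurable_times borel_measurable_const)
        (auto dest: borel_measurable_integrable)
  qed
  also have "\<dots> = (\<Sum>i=1..N. \<integral>\<omega>. (\<Sum>c=1..C. \<sigma> c i * ?G c i (?\<Phi> i \<omega>)) \<partial>?T)"
    by (rule Bochner_Integration.integral_sum) (intro Bochner_Integration.integrable_sum integrable_mult_right int)
  also have "\<dots> = (\<Sum>i=1..N. \<Sum>c=1..C. \<integral>\<omega>. \<sigma> c i * ?G c i (?\<Phi> i \<omega>) \<partial>?T)"
    by (intro sum.cong refl Bochner_Integration.integral_sum integrable_mult_right int)
  also have "\<dots> = (\<Sum>i=1..N. \<Sum>c=1..C. \<sigma> c i *
      Q_value (S i) (A i) (P_ind i) (\<pi> i) \<gamma> (r_comp c i) (s i, a i))"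
    by (intro sum.cong refl) (simp add: Q del: One_nat_def)
  finally show ?thesis .
qed

end
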